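(* Let $D=(V,E)$ be an acyclic digraph of order $N=|V|$. For $v\in V$ let $acc(v)$ denote the accessibility of $v$. Then the average vertex accessibility $\mu_{acc}^{D}=\frac1N\sum_{v\in V}acc(v)$ satisfies $\mu_{acc}^{D}\le \frac{N-1}{2}$.
   Context: "Digraph" means a finite connected (i.e. weakly connected) directed graph without loops and without multiple edges (opposite edges $(u,v)$ and $(v,u)$ may both be present), with more than three vertices. A digraph is acyclic if it contains no directed cycle (directed cycles of length 2 included), equivalently if it has no strongly connected subgraph with more than one vertex. The accessibility $acc(v)$ of a vertex $v$ is the number of other vertices $u\neq v$ that are reachable from $v$ by a directed path. *)

theory Defs
  imports Complex_Main "Graph_Theory.Graph_Theory"
begin

text \<open>
  Cycles of \<^const>\<open>pre_digraph.cycle\<close> are directed and nonempty; a pair of opposite arcs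
  is a cycle of length 2. The library calls the following property \<^const>\<open>forest\<close>,
  a name that is misleading for directed graphs.
\<close>
definition acyclic_digraph :: "('a, 'b) pre_digraph \<Rightarrow> bool" where
  "acyclic_digraph D \<longleftrightarrow> \<not> (\<exists>p. pre_digraph.cycle D p)"

definition accessibility :: "('a, 'b) pre_digraph \<Rightarrow> 'a \<Rightarrow> nat" where
  "accessibility D v = card {u \<in> verts D. u \<noteq> v \<and> v \<rightarrow>\<^sup>*\<^bsub>D\<^esub> u}"

definition avg_accessibility :: "('a, 'b) pre_digraph \<Rightarrow> real" where
  "avg_accessibility D =
    1 / real (card (verts D)) * (\<Sum>v\<in>verts D. real (accessibility D v))"

text \<open>
  \<^const>\<open>digraph\<close> is finite and has neither loops nor multiple arcs, but admits
  opposite arcs; \<^const>\<open>Digraph_Component.connected\<close> is weak connectedness.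
\<close>
definition conn_digraph :: "('a, 'b) pre_digraph \<Rightarrow> bool" where
  "conn_digraph D \<longleftrightarrow>
    digraph D \<and> Digraph_Component.connected D \<and> card (verts D) > 3"

end

(* Mutual reachability of two distinct vertices would produce a directed cycle, so reachability is
   antisymmetric. Each of the N(N-1)/2 unordered pairs of distinct vertices therefore contributes
   at most 1 to the total accessibility. *)
theory Submission
  imports Defs
begin

text \<open>The off-diagonal pairs of \<open>A\<close> related by \<open>R\<close> and their
  converses form disjoint sets of equal size, both inside the \<open>card A * (card A - 1)\<close>
  off-diagonal pairs.\<close>

lemma two_sum_card_antisym_le:
  fixes A :: "'a set"
  assumes "finite A"
    and antisym: "\<And>x y. \<lbrakk>x \<in> A; y \<in> A; R x y; R y x\<rbrakk> \<Longrightarrow> x = y"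
  shows "2 * (\<Sum>x\<in>A. card {y \<in> A. y \<noteq> x \<and> R x y}) \<le> card A * (card A - 1)"
proof -
  let ?S = "SIGMA x:A. {y \<in> A. y \<noteq> x \<and> R x y}"
  have "finite ?S" using \<open>finite A\<close> by auto
  have "?S \<inter> ?S\<inverse> = {}" using antisym by auto
  then have "2 * card ?S = card (?S \<union> ?S\<inverse>)"
    using \<open>finite ?S\<close> by (subst card_Un_disjoint) auto
  also have "\<dots> \<le> card (SIGMA x:A. A - {x})"
    using \<open>finite A\<close> by (intro card_mono) auto
  also have "\<dots> = card A * (card A - 1)"
    using \<open>finite A\<close> by (simp add: card_Diff_singleton)
  finally show ?thesis using \<open>finite A\<close> by simp
qed

lemma (in wf_digraph) acyclic_reachable_antisym:
  assumes "acyclic_digraph G" "u \<rightarrow>\<^sup>* v" "v \<rightarrow>\<^sup>* u"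
  shows "u = v"
proof (rule ccontr)
  assume "u \<noteq> v"
  \<comment> \<open>Distinctness makes the round trip through \<open>v\<close> a nonempty walk, as
    \<open>closed_w\<close> demands; this walk may repeat vertices, but a cycle can be extracted
    from it.\<close>
  with assms(2,3) have "u \<rightarrow>\<^sup>+ u" by (metis reachable_neq_reachable1 reachable1_reachable_trans)
  then have "\<exists>p. closed_w p" by (auto simp: reachable1_awalk closed_w_def)
  then show False
    using closed_w_imp_cycle assms(1) by (auto simp: acyclic_digraph_def)
qed

theorem theorem1:
  fixes D :: "('a, 'b) pre_digraph"
  assumes "conn_digraph D"
    and "acyclic_digraph D"
  shows "avg_accessibility D \<le> (real (card (verts D)) - 1) / 2"
proof -
  let ?N = "card (verts D)"
  interpret digraph D using assms(1) by (simp add: conn_digraph_def)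
  have pos: "?N > 0" using assms(1) by (simp add: conn_digraph_def)
  have "2 * (\<Sum>v\<in>verts D. accessibility D v) \<le> ?N * (?N - 1)"
    unfolding accessibility_def
    by (intro two_sum_card_antisym_le acyclic_reachable_antisym assms(2)) auto
  then have "real (2 * (\<Sum>v\<in>verts D. accessibility D v)) \<le> real (?N * (?N - 1))"
    by (rule of_nat_mono)
  \<comment> \<open>Since \<open>?N\<close> is positive, the truncated \<open>?N - 1\<close> on
    naturals agrees with real subtraction.\<close>
  then have "2 * (\<Sum>v\<in>verts D. real (accessibility D v)) \<le> real ?N * (real ?N - 1)"
    using pos by (simp add: of_nat_diff)
  then have "(\<Sum>v\<in>verts D. real (accessibility D v)) / real ?N \<le> (real ?N - 1) / 2"
    using pos by (simp add: pos_divide_le_eq mult.commute)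
  then show ?thesis
    by (simp add: avg_accessibility_def)
qed

end
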